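(* Suppose $K,E$ are variables and $q$ an indeterminate such that $KE=q^2EK$ and $K$ is invertible. Then for any $n\ge1$, $$T_n(K+K^{-1}+E)=K^n+K^{-n}+E^n+\sum_{r=1}^{n-1}\sum_{j=0}^{n-r}c(n,r,j)\,[E^rK^{n-2j-r}],$$ where $c(n,r,j)\in\mathbb Z[q^{\pm1}]$ is given by $$c(n,r,j)=\frac{[n]_q}{[r]_q}\begin{bmatrix}n-j-1\\ r-1\end{bmatrix}_q\begin{bmatrix}r+j-1\\ r-1\end{bmatrix}_q,$$ and in fact $c(n,r,j)\in\mathbb N[q^{\pm1}]$. Besides, if $q^2$ is a root of unity of order $n$ (i.e. $q$ is specialized to a complex number whose square has order exactly $n$), then $c(n,r,j)=0$ for all $1\le r\le n-1$, $0\le j\le n-r$.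
   Context: $T_n(z)\in\mathbb Z[z]$ are the Chebyshev polynomials of type one: $T_0=2$, $T_1(z)=z$, $T_n(z)=zT_{n-1}(z)-T_{n-2}(z)$ for $n\ge2$. The identity takes place in the $\mathbb Z[q^{\pm1}]$-algebra generated by $E,K,K^{-1}$ subject to $KE=q^2EK$. $[E^aK^b]:=q^{ab}E^aK^b=q^{-ab}K^bE^a$ is the Weyl normalization. For $n\in\mathbb Z$, $k\in\mathbb N$: $[n]_q=\frac{q^n-q^{-n}}{q-q^{-1}}$ and $\begin{bmatrix}n\\k\end{bmatrix}_q=\prod_{j=1}^k\frac{[n-j+1]_q}{[j]_q}$. $\mathbb N$ is the set of non-negative integers. *)

theory Defs
  imports
    Complex_Main
    "HOL-Library.Poly_Mapping"
    "HOL-Computational_Algebra.Polynomial"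
    "HOL-Computational_Algebra.Polynomial_Factorial"
begin

section \<open>Laurent polynomials in q\<close>

text \<open>The group ring of \<open>\<int>\<close> over \<open>\<int>\<close>: the mapping \<open>p\<close> stands for the sum of
  \<open>lookup p k \<cdot> q\<^sup>k\<close> over \<open>k\<close>.\<close>

type_synonym laurent = "int \<Rightarrow>\<^sub>0 int"

definition qpow :: "int \<Rightarrow> laurent"
  where "qpow k = Poly_Mapping.single k 1"

lemma qpow_add: "qpow (a + b) = qpow a * qpow b"
  by (simp add: qpow_def mult_single)

lemma qpow_0 [simp]: "qpow 0 = 1"
  by (simp add: qpow_def)

definition nonneg_laurent :: "laurent \<Rightarrow> bool"
  where "nonneg_laurent p \<longleftrightarrow> (\<forall>k. 0 \<le> Poly_Mapping.lookup p k)"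

text \<open>Specialization of \<open>q\<close> to a complex number; only meaningful for \<open>z \<noteq> 0\<close>.\<close>

definition laurent_eval :: "complex \<Rightarrow> laurent \<Rightarrow> complex"
  where "laurent_eval z p = (\<Sum>k\<in>Poly_Mapping.keys p. of_int (Poly_Mapping.lookup p k) * z powi k)"

definition has_mult_order :: "complex \<Rightarrow> nat \<Rightarrow> bool"
  where "has_mult_order w n \<longleftrightarrow> 0 < n \<and> w ^ n = 1 \<and> (\<forall>m. 0 < m \<and> m < n \<longrightarrow> w ^ m \<noteq> 1)"


section \<open>Quantum integers and binomials, in the fraction field of the Laurent polynomials\<close>

definition qint :: "int \<Rightarrow> laurent fract"
  where "qint n = to_fract (qpow n - qpow (- n)) / to_fract (qpow 1 - qpow (- 1))"

definition qbinom :: "int \<Rightarrow> nat \<Rightarrow> laurent fract"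
  where "qbinom n k = (\<Prod>j = 1..k. qint (n - int j + 1) / qint (int j))"

definition c_frac :: "nat \<Rightarrow> nat \<Rightarrow> nat \<Rightarrow> laurent fract"
  where "c_frac n r j =
    qint (int n) / qint (int r)
      * qbinom (int n - int j - 1) (r - 1)
      * qbinom (int r + int j - 1) (r - 1)"


section \<open>Chebyshev polynomials\<close>

fun chebT :: "nat \<Rightarrow> int poly"
  where
    "chebT 0 = [:2:]"
  | "chebT (Suc 0) = [:0, 1:]"
  | "chebT (Suc (Suc n)) = [:0, 1:] * chebT (Suc n) - chebT n"

text \<open>The library's \<open>poly\<close> evaluates only in commutative semirings.\<close>

definition ipoly_at :: "int poly \<Rightarrow> 'a::ring_1 \<Rightarrow> 'a"
  where "ipoly_at p x = (\<Sum>i\<le>degree p. of_int (coeff p i) * x ^ i)"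


section \<open>The algebra generated by E, K and the inverse of K, subject to K E = q^2 E K\<close>

text \<open>The presented algebra: terms over the generators and the scalars, modulo the least
  congruence that contains the axioms of an associative unital algebra over the Laurent
  polynomials and the defining relations. The zero and the unit are the images of the scalars
  \<open>0\<close> and \<open>1\<close>.\<close>

datatype qterm =
    Scal laurent
  | GenE
  | GenK
  | GenKinv
  | Add qterm qterm
  | Neg qterm
  | Mul qterm qterm

inductive qcong :: "qterm \<Rightarrow> qterm \<Rightarrow> bool"
  where
    refl: "qcong x x"
  | sym: "qcong x y \<Longrightarrow> qcong y x"
  | trans: "qcong x y \<Longrightarrow> qcong y z \<Longrightarrow> qcong x z"
  | add_cong: "qcong x x' \<Longrightarrow> qcong y y' \<Longrightarrow> qcong (Add x y) (Add x' y')"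
  | neg_cong: "qcong x x' \<Longrightarrow> qcong (Neg x) (Neg x')"
  | mul_cong: "qcong x x' \<Longrightarrow> qcong y y' \<Longrightarrow> qcong (Mul x y) (Mul x' y')"
  | add_assoc: "qcong (Add (Add x y) z) (Add x (Add y z))"
  | add_comm: "qcong (Add x y) (Add y x)"
  | add_zero: "qcong (Add (Scal 0) x) x"
  | add_neg: "qcong (Add (Neg x) x) (Scal 0)"
  | mul_assoc: "qcong (Mul (Mul x y) z) (Mul x (Mul y z))"
  | one_mul: "qcong (Mul (Scal 1) x) x"
  | mul_one: "qcong (Mul x (Scal 1)) x"
  | distrib_right: "qcong (Mul (Add x y) z) (Add (Mul x z) (Mul y z))"
  | distrib_left: "qcong (Mul x (Add y z)) (Add (Mul x y) (Mul x z))"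
  | scal_add: "qcong (Scal (a + b)) (Add (Scal a) (Scal b))"
  | scal_mul: "qcong (Scal (a * b)) (Mul (Scal a) (Scal b))"
  | scal_central: "qcong (Mul (Scal a) x) (Mul x (Scal a))"
  | K_Kinv: "qcong (Mul GenK GenKinv) (Scal 1)"
  | Kinv_K: "qcong (Mul GenKinv GenK) (Scal 1)"
  | K_E: "qcong (Mul GenK GenE) (Mul (Scal (qpow 2)) (Mul GenE GenK))"

text \<open>The character \<open>E \<mapsto> 0\<close>, \<open>K \<mapsto> 1\<close>, which shows that \<open>0 \<noteq> 1\<close> in the quotient.\<close>

primrec augm :: "qterm \<Rightarrow> laurent"
  where
    "augm (Scal a) = a"
  | "augm GenE = 0"
  | "augm GenK = 1"
  | "augm GenKinv = 1"
  | "augm (Add x y) = augm x + augm y"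
  | "augm (Neg x) = - augm x"
  | "augm (Mul x y) = augm x * augm y"

lemma qcong_augm: "qcong x y \<Longrightarrow> augm x = augm y"
  by (induction rule: qcong.induct) (simp_all add: algebra_simps)

quotient_type qalg = qterm / qcong
proof (rule equivpI)
  show "reflp qcong" by (rule reflpI) (rule qcong.refl)
  show "symp qcong" by (rule sympI) (rule qcong.sym)
  show "transp qcong" by (rule transpI) (rule qcong.trans)
qed

instantiation qalg :: ring_1
begin

lift_definition zero_qalg :: qalg is "Scal 0" .
lift_definition one_qalg :: qalg is "Scal 1" .
lift_definition plus_qalg :: "qalg \<Rightarrow> qalg \<Rightarrow> qalg" is Add by (rule qcong.add_cong)
lift_definition uminus_qalg :: "qalg \<Rightarrow> qalg" is Neg by (rule qcong.neg_cong)
lift_definition minus_qalg :: "qalg \<Rightarrow> qalg \<Rightarrow> qalg" is "\<lambda>x y. Add x (Neg y)"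
  by (intro qcong.add_cong qcong.neg_cong)
lift_definition times_qalg :: "qalg \<Rightarrow> qalg \<Rightarrow> qalg" is Mul by (rule qcong.mul_cong)

instance
proof
  fix a b c :: qalg
  show "a + b + c = a + (b + c)" by transfer (rule qcong.add_assoc)
  show "a + b = b + a" by transfer (rule qcong.add_comm)
  show "0 + a = a" by transfer (rule qcong.add_zero)
  show "- a + a = 0" by transfer (rule qcong.add_neg)
  show "a - b = a + - b" by transfer (rule qcong.refl)
  show "a * b * c = a * (b * c)" by transfer (rule qcong.mul_assoc)
  show "1 * a = a" by transfer (rule qcong.one_mul)
  show "a * 1 = a" by transfer (rule qcong.mul_one)
  show "(a + b) * c = a * c + b * c" by transfer (rule qcong.distrib_right)
  show "a * (b + c) = a * b + a * c" by transfer (rule qcong.distrib_left)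
  show "(0::qalg) \<noteq> 1"
  proof transfer
    show "\<not> qcong (Scal 0) (Scal 1)"
      using qcong_augm[of "Scal 0" "Scal 1"] by auto
  qed
qed

end

lift_definition scal :: "laurent \<Rightarrow> qalg" is Scal .
lift_definition genE :: qalg is GenE .
lift_definition genK :: qalg is GenK .
lift_definition genKinv :: qalg is GenKinv .

lemma scal_0: "scal 0 = 0"
  by transfer (rule qcong.refl)

lemma scal_1: "scal 1 = 1"
  by transfer (rule qcong.refl)

lemma scal_add: "scal (a + b) = scal a + scal b"
  by transfer (rule qcong.scal_add)

lemma scal_mult: "scal (a * b) = scal a * scal b"
  by transfer (rule qcong.scal_mul)

lemma scal_central: "scal a * x = x * scal a"
  by transfer (rule qcong.scal_central)

lemma genK_genKinv: "genK * genKinv = 1"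
  by transfer (rule qcong.K_Kinv)

lemma genKinv_genK: "genKinv * genK = 1"
  by transfer (rule qcong.Kinv_K)

lemma genK_genE: "genK * genE = scal (qpow 2) * (genE * genK)"
  by transfer (rule qcong.K_E)

definition Kpow :: "int \<Rightarrow> qalg"
  where "Kpow b = (if 0 \<le> b then genK ^ nat b else genKinv ^ nat (- b))"

definition weyl :: "nat \<Rightarrow> int \<Rightarrow> qalg"
  where "weyl a b = scal (qpow (int a * b)) * genE ^ a * Kpow b"

lemma scal_left_commute: "x * (scal a * y) = scal a * (x * y)"
  by (simp only: mult.assoc[symmetric] scal_central[of a x])

lemma scal_qpow_scal: "scal (qpow a) * (scal (qpow b) * x) = scal (qpow (a + b)) * x"
  by (simp only: mult.assoc[symmetric] scal_mult[symmetric] qpow_add)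

lemma pow_q_commute:
  assumes "x * y = scal (qpow s) * (y * x)"
  shows "x * y ^ k = scal (qpow (int k * s)) * (y ^ k * x)"
proof (induction k)
  case 0
  show ?case by (simp add: scal_1)
next
  case (Suc k)
  have "x * y ^ Suc k = (x * y) * y ^ k"
    by (simp only: power_Suc mult.assoc)
  also have "\<dots> = scal (qpow s) * (y * (x * y ^ k))"
    by (simp only: assms mult.assoc)
  also have "\<dots> = scal (qpow (s + int k * s)) * (y * (y ^ k * x))"
    by (simp only: Suc scal_left_commute[of y] scal_qpow_scal)
  also have "s + int k * s = int (Suc k) * s"
    by (simp add: algebra_simps)
  finally show ?case by (simp only: power_Suc mult.assoc)
qed

lemma pow_pow_q_commute:
  assumes "x * y = scal (qpow s) * (y * x)"
  shows "x ^ m * y ^ k = scal (qpow (int m * int k * s)) * (y ^ k * x ^ m)"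
proof (induction m)
  case 0
  show ?case by (simp add: scal_1)
next
  case (Suc m)
  have "x ^ Suc m * y ^ k = x * (x ^ m * y ^ k)"
    by (simp only: power_Suc mult.assoc)
  also have "\<dots> = scal (qpow (int m * int k * s)) * ((x * y ^ k) * x ^ m)"
    by (simp only: Suc scal_left_commute[of x] mult.assoc)
  also have "\<dots> = scal (qpow (int m * int k * s + int k * s)) * (y ^ k * (x * x ^ m))"
    by (simp only: pow_q_commute[OF assms] mult.assoc scal_qpow_scal)
  also have "int m * int k * s + int k * s = int (Suc m) * int k * s"
    by (simp add: algebra_simps)
  finally show ?case by (simp only: power_Suc)
qed

lemma genKinv_genE: "genKinv * genE = scal (qpow (- 2)) * (genE * genKinv)"
proof -
  have "genE * genKinv = genKinv * (genK * (genE * genKinv))"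
    by (simp only: mult.assoc[symmetric] genKinv_genK mult_1_left)
  also have "genK * (genE * genKinv) = scal (qpow 2) * (genE * (genK * genKinv))"
    by (simp only: mult.assoc[symmetric] genK_genE)
  also have "genKinv * (scal (qpow 2) * (genE * (genK * genKinv))) = scal (qpow 2) * (genKinv * genE)"
    by (simp only: scal_left_commute genK_genKinv mult_1_right)
  finally show ?thesis
    by (simp add: scal_qpow_scal scal_1)
qed

lemma weyl_altdef: "weyl a b = scal (qpow (- (int a * b))) * Kpow b * genE ^ a"
proof -
  have *: "Kpow b * genE ^ a = scal (qpow (2 * (int a * b))) * (genE ^ a * Kpow b)"
  proof (cases "0 \<le> b")
    case True
    have "int (nat b) * int a * 2 = 2 * (int a * b)" using True by simp
    thus ?thesis
      using True pow_pow_q_commute[OF genK_genE, of "nat b" a] by (simp only: Kpow_def if_True)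
  next
    case False
    have "int (nat (- b)) * int a * (- 2) = 2 * (int a * b)" using False by simp
    thus ?thesis
      using False pow_pow_q_commute[OF genKinv_genE, of "nat (- b)" a] by (simp only: Kpow_def if_False)
  qed
  have "- (int a * b) + 2 * (int a * b) = int a * b" by simp
  thus ?thesis
    by (simp only: weyl_def mult.assoc * scal_qpow_scal)
qed

end

theory Submission
  imports Defs
begin

text \<open>The Chebyshev recursion determines the elements \<open>T\<^sub>n (K + K\<^sup>-\<^sup>1 + E)\<close>, so it suffices to
  show that the right-hand side satisfies it. Left multiplication by the generators acts on Weyl
  monomials by
  \<open>K [E\<^sup>r K\<^sup>b] = q\<^sup>r [E\<^sup>r K\<^sup>b\<^sup>+\<^sup>1]\<close>, \<open>K\<^sup>-\<^sup>1 [E\<^sup>r K\<^sup>b] = q\<^sup>-\<^sup>r [E\<^sup>r K\<^sup>b\<^sup>-\<^sup>1]\<close> and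
  \<open>E [E\<^sup>r K\<^sup>b] = q\<^sup>-\<^sup>b [E\<^sup>r\<^sup>+\<^sup>1 K\<^sup>b]\<close>.
  With \<open>m = n - r - j\<close>, so that the monomials are \<open>[E\<^sup>r K\<^sup>m\<^sup>-\<^sup>j]\<close>, the recursion becomes the four-term
  recurrence \<open>cheb_coeff_int_recurrence\<close> for coefficients \<open>D(r, m, j)\<close>:

  \<open>D(r,m,j) = q\<^sup>r D(r,m-1,j) + q\<^sup>-\<^sup>r D(r,m,j-1) + q\<^sup>j\<^sup>-\<^sup>m D(r-1,m,j) - D(r,m-1,j-1)\<close>.

  The powers of \<open>K\<close> and the monomial \<open>E\<^sup>n\<close> fit the same pattern as the rows \<open>r = 0\<close> and \<open>r = n\<close>.
  For \<open>r > 0\<close> the claimed coefficient is \<open>[n] / [r]\<close> times the Gaussian binomials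
  \<open>r + m - 1\<close> over \<open>r - 1\<close> and \<open>r + j - 1\<close> over \<open>r - 1\<close>. For \<open>r > 1\<close> its neighbours in
  the recurrence are multiples of the same two binomials by quotients of quantum integers, and dividing
  these out leaves the identity \<open>qdiff_identity\<close>. For \<open>r = 1\<close> the neighbour in
  the row \<open>r = 0\<close> is zero unless \<open>m = 0\<close> or \<open>j = 0\<close>, so that only this boundary needs a separate
  computation.

  The remaining claims come from two forms of the coefficient. Splitting
  \<open>[n] = q\<^sup>j [r + m] + q\<^sup>-\<^sup>(\<^sup>r\<^sup>+\<^sup>m\<^sup>) [j]\<close> turns it into a sum of products of Gaussian binomials
  and powers of \<open>q\<close>, hence into a Laurent polynomial with nonnegative coefficients; this is the
  definition of \<open>cheb_coeff\<close>. Clearing the denominator, in \<open>cheb_coeff_product\<close>, gives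
  \<open>(q\<^sup>r - q\<^sup>-\<^sup>r) D(r,m,j) = (q\<^sup>n - q\<^sup>-\<^sup>n)\<close> times two Gaussian binomials. If \<open>q\<^sup>2\<close> has order \<open>n\<close>,
  the right-hand side vanishes but the factor \<open>q\<^sup>r - q\<^sup>-\<^sup>r\<close> does not for \<open>0 < r < n\<close>.\<close>

section \<open>Gaussian binomials as Laurent polynomials\<close>

definition qdiff :: "int \<Rightarrow> laurent"
  where "qdiff k = qpow k - qpow (- k)"

lemma qdiff_0 [simp]: "qdiff 0 = 0"
  by (simp add: qdiff_def)

lemma qdiff_eq_0_iff [simp]: "qdiff k = 0 \<longleftrightarrow> k = 0"
  by (auto simp: qdiff_def qpow_def frag_of_eq)

lemma qpow_mult_qpow: "qpow a * qpow b = qpow (a + b)"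
  by (simp add: qpow_add)

lemma qpow_mult_qpow_left: "qpow a * (qpow b * x) = qpow (a + b) * x"
  by (simp add: qpow_add mult.assoc)

lemmas qpow_collect = qdiff_def qpow_mult_qpow qpow_mult_qpow_left

text \<open>The splitting of \<open>[a + b]\<close> behind both the \<open>q\<close>-Pascal rule and the positive
  formula for the Chebyshev coefficients.\<close>
lemma qdiff_add: "qdiff (a + b) = qpow a * qdiff b + qpow (- b) * qdiff a"
  by (simp add: qpow_collect algebra_simps)

text \<open>\<open>qgauss a b\<close> is the symmetric Gaussian binomial \<open>a + b\<close> over \<open>a\<close>. Taking the
  \<open>q\<close>-Pascal rule as definition makes it a Laurent polynomial with nonnegative coefficients from
  the start; that it is the quotient of quantum factorials is derived below.\<close>
fun qgauss :: "nat \<Rightarrow> nat \<Rightarrow> laurent"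
  where
    "qgauss 0 b = 1"
  | "qgauss (Suc a) 0 = 1"
  | "qgauss (Suc a) (Suc b) =
      qpow (int (Suc a)) * qgauss (Suc a) b + qpow (- int (Suc b)) * qgauss a (Suc b)"

lemma qgauss_0_right [simp]: "qgauss a 0 = 1"
  by (cases a) simp_all

text \<open>Up to the factor \<open>(q - q\<^sup>-\<^sup>1)\<^sup>a\<close> this is the quantum factorial of \<open>a\<close>.\<close>
definition qdiff_fact :: "nat \<Rightarrow> laurent"
  where "qdiff_fact a = (\<Prod>i=1..a. qdiff (int i))"

lemma qdiff_fact_0 [simp]: "qdiff_fact 0 = 1"
  by (simp add: qdiff_fact_def)

lemma qdiff_fact_Suc: "qdiff_fact (Suc a) = qdiff (int (Suc a)) * qdiff_fact a"
  by (simp add: qdiff_fact_def mult.commute)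

lemma qdiff_fact_nonzero [simp]: "qdiff_fact a \<noteq> 0"
  by (induction a) (simp_all add: qdiff_fact_Suc)

text \<open>Multiplied by the factorials, the \<open>q\<close>-Pascal rule is the splitting of
  \<open>q\<^sup>N - q\<^sup>-\<^sup>N\<close> for \<open>N = (a + 1) + (b + 1)\<close>.\<close>
lemma qgauss_factorial: "qdiff_fact a * qdiff_fact b * qgauss a b = qdiff_fact (a + b)"
proof (induction a b rule: qgauss.induct)
  case (3 a b)
  have "qdiff_fact (Suc a) * qdiff_fact (Suc b) * qgauss (Suc a) (Suc b)
      = qpow (int (Suc a)) * qdiff (int (Suc b))
          * (qdiff_fact (Suc a) * qdiff_fact b * qgauss (Suc a) b)
      + qpow (- int (Suc b)) * qdiff (int (Suc a))
          * (qdiff_fact a * qdiff_fact (Suc b) * qgauss a (Suc b))"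
    by (simp add: qdiff_fact_Suc algebra_simps del: of_nat_Suc)
  also have "\<dots> = qdiff (int (Suc a) + int (Suc b)) * qdiff_fact (Suc (a + b))"
    unfolding 3 qdiff_add[of "int (Suc a)" "int (Suc b)"]
    by (simp only: ring_distribs add_Suc add_Suc_right)
  also have "\<dots> = qdiff_fact (Suc a + Suc b)"
    by (simp add: qdiff_fact_Suc[of "Suc (a + b)"] add_ac)
  finally show ?case .
qed simp_all

lemma qgauss_Suc_left:
  "qdiff (int (Suc a)) * qgauss (Suc a) b = qdiff (int (Suc (a + b))) * qgauss a b"
proof -
  have "qdiff_fact a * qdiff_fact b * (qdiff (int (Suc a)) * qgauss (Suc a) b)
      = qdiff_fact (Suc (a + b))"
    using qgauss_factorial[of "Suc a" b] by (simp only: qdiff_fact_Suc add_Suc mult_ac)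
  also have "\<dots> = qdiff_fact a * qdiff_fact b * (qdiff (int (Suc (a + b))) * qgauss a b)"
    by (simp only: qdiff_fact_Suc qgauss_factorial[symmetric] mult_ac)
  finally show ?thesis by simp
qed

lemma qgauss_Suc_right:
  "qdiff (int (Suc b)) * qgauss a (Suc b) = qdiff (int (Suc (a + b))) * qgauss a b"
proof -
  have "qdiff_fact a * qdiff_fact b * (qdiff (int (Suc b)) * qgauss a (Suc b))
      = qdiff_fact (Suc (a + b))"
    using qgauss_factorial[of a "Suc b"] by (simp only: qdiff_fact_Suc add_Suc_right mult_ac)
  also have "\<dots> = qdiff_fact a * qdiff_fact b * (qdiff (int (Suc (a + b))) * qgauss a b)"
    by (simp only: qdiff_fact_Suc qgauss_factorial[symmetric] mult_ac)
  finally show ?thesis by simp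
qed

section \<open>Comparison with the fraction field\<close>

lemma qint_eq: "qint n = to_fract (qdiff n) / to_fract (qdiff 1)"
  by (simp add: qint_def qdiff_def)

lemma qint_divide: "qint m / qint k = to_fract (qdiff m) / to_fract (qdiff k)"
  by (simp add: qint_eq)

text \<open>Raising the lower index by one at a fixed upper index replaces \<open>(a, b + 1)\<close> by
  \<open>(a + 1, b)\<close>; both \<open>qgauss\<close> values are the same multiple of \<open>qgauss a b\<close>.\<close>
lemma qbinom_eq_qgauss: "qbinom (int a + int b) a = to_fract (qgauss a b)"
proof (induction a arbitrary: b)
  case 0
  show ?case by (simp add: qbinom_def)
next
  case (Suc a)
  have "qbinom (int (Suc a) + int b) (Suc a)
      = qbinom (int a + int (Suc b)) a * (qint (int (Suc b)) / qint (int (Suc a)))"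
    by (simp add: qbinom_def algebra_simps)
  also have "\<dots> = to_fract (qdiff (int (Suc b)) * qgauss a (Suc b)) / to_fract (qdiff (int (Suc a)))"
    by (simp only: Suc qint_divide to_fract_mult) simp
  also have "qdiff (int (Suc b)) * qgauss a (Suc b) = qdiff (int (Suc a)) * qgauss (Suc a) b"
    by (simp only: qgauss_Suc_left qgauss_Suc_right)
  finally show ?case by simp
qed

section \<open>The coefficients of the expansion\<close>

text \<open>The coefficient of the Weyl monomial \<open>[E\<^sup>r K\<^sup>m\<^sup>-\<^sup>j]\<close> in \<open>T\<^sub>n\<close>, where \<open>n = r + m + j\<close>. In these
  variables the roles of \<open>K\<close> and its inverse are exchanged by swapping \<open>m\<close> and \<open>j\<close>. For \<open>r > 0\<close> the
  product formula has a denominator \<open>[r]\<close>. The sum used here results from splitting the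
  numerator \<open>[n]\<close> into \<open>q\<^sup>j [r + m] + q\<^sup>-\<^sup>(\<^sup>r\<^sup>+\<^sup>m\<^sup>) [j]\<close> and absorbing \<open>[r + m] / [r]\<close> and
  \<open>[j] / [r]\<close> into the two binomials: it is visibly integral and nonnegative. For \<open>r = 0\<close> the
  values are the coefficients of \<open>K\<^sup>n + K\<^sup>-\<^sup>n\<close>, which is \<open>2\<close> if \<open>n = 0\<close>.\<close>
definition cheb_coeff :: "nat \<Rightarrow> nat \<Rightarrow> nat \<Rightarrow> laurent"
  where "cheb_coeff r m j = (case r of
      0 \<Rightarrow> (if m = 0 then 1 else 0) + (if j = 0 then 1 else 0)
    | Suc a \<Rightarrow> qpow (int j) * qgauss (Suc a) m * qgauss a j
        + (case j of 0 \<Rightarrow> 0 | Suc i \<Rightarrow> qpow (- int (r + m)) * qgauss a m * qgauss (Suc a) i))"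

text \<open>The product formula for the coefficients with its denominator cleared. It gives the
  quotient in the fraction field, the vanishing at roots of unity and the recurrence.\<close>
lemma cheb_coeff_product:
  "qdiff (int (Suc a)) * cheb_coeff (Suc a) m j = qdiff (int (Suc a + m + j)) * qgauss a m * qgauss a j"
proof -
  define X where "X = (case j of 0 \<Rightarrow> 0 | Suc i \<Rightarrow> qgauss (Suc a) i)"
  have X: "qdiff (int (Suc a)) * X = qdiff (int j) * qgauss a j"
  proof (cases j)
    case (Suc i)
    thus ?thesis
      by (simp only: X_def nat.case qgauss_Suc_left qgauss_Suc_right)
  qed (simp add: X_def)
  have "cheb_coeff (Suc a) m j = qpow (int j) * qgauss (Suc a) m * qgauss a j
      + qpow (- int (Suc a + m)) * qgauss a m * X"
    by (simp add: cheb_coeff_def X_def split: nat.split)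
  hence "qdiff (int (Suc a)) * cheb_coeff (Suc a) m j
      = qpow (int j) * (qdiff (int (Suc a)) * qgauss (Suc a) m) * qgauss a j
      + qpow (- int (Suc a + m)) * qgauss a m * (qdiff (int (Suc a)) * X)"
    by (simp only: ring_distribs mult_ac)
  also have "\<dots> = (qpow (int j) * qdiff (int (Suc a + m)) + qpow (- int (Suc a + m)) * qdiff (int j))
        * qgauss a m * qgauss a j"
    by (simp only: X qgauss_Suc_left add_Suc, simp only: ring_distribs mult_ac)
  also have "\<dots> = qdiff (int j + int (Suc a + m)) * qgauss a m * qgauss a j"
    by (simp only: qdiff_add)
  finally show ?thesis by (simp add: algebra_simps)
qed

lemma to_fract_cheb_coeff:
  assumes "1 \<le> r" "r + j \<le> n"
  shows "to_fract (cheb_coeff r (n - r - j) j) = c_frac n r j"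
proof -
  obtain a where r: "r = Suc a" using assms by (cases r) auto
  define m where "m = n - r - j"
  have n: "n = Suc a + m + j" using assms by (simp add: m_def r)
  have "to_fract (qdiff (int (Suc a))) * to_fract (cheb_coeff r m j)
     = to_fract (qdiff (int n)) * to_fract (qgauss a m) * to_fract (qgauss a j)"
    unfolding r n by (simp only: to_fract_mult[symmetric] cheb_coeff_product)
  hence "to_fract (cheb_coeff r m j)
     = to_fract (qdiff (int n)) / to_fract (qdiff (int r))
         * to_fract (qgauss a m) * to_fract (qgauss a j)"
    by (simp add: r field_simps del: of_nat_Suc)
  also have "\<dots> = c_frac n r j"
    by (simp add: c_frac_def qint_divide r n qbinom_eq_qgauss[symmetric] algebra_simps)
  finally show ?thesis by (simp add: m_def)
qed

section \<open>Nonnegativity\<close>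

lemma nonneg_laurent_0: "nonneg_laurent 0"
  and nonneg_laurent_1: "nonneg_laurent 1"
  and nonneg_laurent_qpow: "nonneg_laurent (qpow k)"
  by (auto simp: nonneg_laurent_def qpow_def lookup_single lookup_one when_def)

lemma nonneg_laurent_add: "nonneg_laurent p \<Longrightarrow> nonneg_laurent p' \<Longrightarrow> nonneg_laurent (p + p')"
  by (simp add: nonneg_laurent_def lookup_add)

lemma Sum_any_nonneg: "(\<And>x. (0::int) \<le> f x) \<Longrightarrow> 0 \<le> Sum_any f"
  by (simp add: Sum_any.expand_set sum_nonneg)

lemma nonneg_laurent_mult: "nonneg_laurent p \<Longrightarrow> nonneg_laurent p' \<Longrightarrow> nonneg_laurent (p * p')"
  by (auto simp: nonneg_laurent_def lookup_mult when_def intro!: Sum_any_nonneg mult_nonneg_nonneg)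

lemmas nonneg_laurent_intros = nonneg_laurent_0 nonneg_laurent_1 nonneg_laurent_qpow
  nonneg_laurent_add nonneg_laurent_mult

lemma nonneg_laurent_qgauss: "nonneg_laurent (qgauss a b)"
  by (induction a b rule: qgauss.induct) (auto intro!: nonneg_laurent_intros)

lemma nonneg_laurent_cheb_coeff: "nonneg_laurent (cheb_coeff r m j)"
  by (simp only: cheb_coeff_def split: nat.split)
    (intro allI impI conjI nonneg_laurent_intros nonneg_laurent_qgauss;
      simp add: nonneg_laurent_intros)

section \<open>Vanishing at roots of unity\<close>

lemma laurent_eval_superset:
  assumes "finite A" "Poly_Mapping.keys p \<subseteq> A"
  shows "laurent_eval z p = (\<Sum>k\<in>A. of_int (Poly_Mapping.lookup p k) * z powi k)"
  unfolding laurent_eval_def using assms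
  by (intro sum.mono_neutral_left) (auto simp: in_keys_iff)

lemma laurent_eval_diff: "laurent_eval z (p - p') = laurent_eval z p - laurent_eval z p'"
proof -
  let ?A = "Poly_Mapping.keys p \<union> Poly_Mapping.keys p'"
  have "Poly_Mapping.keys (p - p') \<subseteq> ?A" by (rule keys_diff)
  thus ?thesis
    by (simp add: laurent_eval_superset[of ?A] lookup_minus algebra_simps sum_subtractf)
qed

text \<open>Multiplicativity in this special case suffices, because only products with
  \<open>q\<^sup>a - q\<^sup>-\<^sup>a\<close> are evaluated.\<close>
lemma laurent_eval_qpow_mult:
  assumes "z \<noteq> 0"
  shows "laurent_eval z (qpow a * p) = z powi a * laurent_eval z p"
proof -
  have "Poly_Mapping.keys p \<subseteq> UNIV" by simp
  thus ?thesis
  proof (induction p rule: frag_induction)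
    case zero
    show ?case by (simp add: laurent_eval_def)
  next
    case (one x)
    show ?case using assms by (simp add: qpow_def mult_single laurent_eval_def power_int_add)
  next
    case (diff p p')
    thus ?case by (simp add: laurent_eval_diff right_diff_distrib)
  qed
qed

lemma laurent_eval_qdiff_mult:
  assumes "z \<noteq> 0"
  shows "laurent_eval z (qdiff a * p) = (z powi a - z powi (- a)) * laurent_eval z p"
  using assms by (simp add: qdiff_def left_diff_distrib laurent_eval_diff laurent_eval_qpow_mult)

lemma powi_eq_powi_minus_iff:
  fixes z :: complex
  assumes "z \<noteq> 0"
  shows "z powi int k = z powi (- int k) \<longleftrightarrow> (z\<^sup>2) ^ k = 1"
proof -
  have "(z\<^sup>2) ^ k = z ^ k * z ^ k" by (simp add: power2_eq_square power_mult_distrib)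
  thus ?thesis using assms by (auto simp: power_int_minus field_simps)
qed

text \<open>If \<open>z\<^sup>2\<close> has order \<open>n\<close>, then \<open>q\<^sup>n - q\<^sup>-\<^sup>n\<close> vanishes at \<open>z\<close> whereas \<open>q\<^sup>r - q\<^sup>-\<^sup>r\<close> does not
  for \<open>0 < r < n\<close>. So the cleared product formula forces the coefficient to vanish.\<close>
lemma laurent_eval_cheb_coeff_root_of_unity:
  assumes "has_mult_order (z\<^sup>2) n" "1 \<le> r" "r < n" "n = r + m + j"
  shows "laurent_eval z (cheb_coeff r m j) = 0"
proof -
  obtain a where r: "r = Suc a" using assms by (cases r) auto
  have ord: "(z\<^sup>2) ^ n = 1" "(z\<^sup>2) ^ r \<noteq> 1" "z \<noteq> 0"
    using assms by (auto simp: has_mult_order_def power_0_left)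
  have "(z powi int r - z powi (- int r)) * laurent_eval z (cheb_coeff r m j)
      = laurent_eval z (qdiff (int n) * (qgauss a m * qgauss a j))"
    using cheb_coeff_product[of a m j] assms(4)
    by (simp only: laurent_eval_qdiff_mult[OF ord(3), symmetric] r mult.assoc)
  also have "\<dots> = 0"
    using ord powi_eq_powi_minus_iff[of z n] by (simp add: laurent_eval_qdiff_mult)
  finally show ?thesis
    using ord powi_eq_powi_minus_iff[of z r] by simp
qed

section \<open>The recurrence for the coefficients\<close>

text \<open>Extension by zero to negative arguments. It makes the index-shift rules and the recurrence
  valid without exceptions at the boundary.\<close>
definition qgauss_int :: "int \<Rightarrow> int \<Rightarrow> laurent"
  where "qgauss_int a b = (if a < 0 \<or> b < 0 then 0 else qgauss (nat a) (nat b))"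

definition cheb_coeff_int :: "int \<Rightarrow> int \<Rightarrow> int \<Rightarrow> laurent"
  where "cheb_coeff_int r m j =
    (if r < 0 \<or> m < 0 \<or> j < 0 then 0 else cheb_coeff (nat r) (nat m) (nat j))"

lemma cheb_coeff_int_neg: "r < 0 \<or> m < 0 \<or> j < 0 \<Longrightarrow> cheb_coeff_int r m j = 0"
  by (simp add: cheb_coeff_int_def)

lemma qgauss_int_shift_right:
  assumes "a \<ge> 0"
  shows "qdiff m * qgauss_int a m = qdiff (a + m) * qgauss_int a (m - 1)"
proof -
  consider "m < 0" | "m = 0" | b where "m = int (Suc b)"
    by (cases m rule: int_cases3) (auto elim: lessE)
  thus ?thesis
  proof cases
    case 3
    thus ?thesis
      using assms qgauss_Suc_right[of b "nat a"]
      by (simp add: qgauss_int_def nat_add_distrib algebra_simps)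
  qed (simp_all add: qgauss_int_def)
qed

lemma qgauss_int_shift_left:
  assumes "a \<ge> 1"
  shows "qdiff a * qgauss_int a m = qdiff (a + m) * qgauss_int (a - 1) m"
proof -
  obtain b where "a = int (Suc b)"
    using assms that[of "nat (a - 1)"] by simp
  thus ?thesis
    using qgauss_Suc_left[of b "nat m"] by (auto simp: qgauss_int_def nat_add_distrib algebra_simps)
qed

lemma cheb_coeff_int_product:
  assumes "r \<ge> 1"
  shows "qdiff r * cheb_coeff_int r m j
    = qdiff (r + m + j) * qgauss_int (r - 1) m * qgauss_int (r - 1) j"
proof -
  obtain b where "r = int (Suc b)"
    using assms that[of "nat (r - 1)"] by simp
  thus ?thesis
    using cheb_coeff_product[of b "nat m" "nat j"]
    by (auto simp: qgauss_int_def cheb_coeff_int_def nat_add_distrib algebra_simps)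
qed

lemma cheb_coeff_int_0:
  "m \<ge> 0 \<Longrightarrow> j \<ge> 0 \<Longrightarrow> cheb_coeff_int 0 m j = (if m = 0 then 1 else 0) + (if j = 0 then 1 else 0)"
  by (auto simp: cheb_coeff_int_def cheb_coeff_def)

text \<open>What remains of the recurrence for \<open>r = a + 1\<close> after the common binomial factors have been
  divided out: an identity between Laurent monomials in \<open>q\<^sup>a\<close>, \<open>q\<^sup>m\<close>, \<open>q\<^sup>j\<close> and \<open>q\<close>.\<close>
lemma qdiff_identity:
  "qdiff (a + 1 + m + j) * qdiff (a + m) * qdiff (a + j) =
     qpow (a + 1) * qdiff (a + m + j) * qdiff m * qdiff (a + j)
   + qpow (- (a + 1)) * qdiff (a + m + j) * qdiff j * qdiff (a + m)
   + qpow (j - m) * qdiff (a + m + j) * qdiff a * qdiff (a + 1)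
   - qdiff (a + m + j - 1) * qdiff m * qdiff j"
  \<comment> \<open>After both sides are expanded into monomials, the last step only sorts the exponents.\<close>
  by (simp add: qpow_collect ring_distribs mult.assoc, simp add: algebra_simps,
      simp only: diff_conv_add_uminus minus_add_distrib add_ac)

text \<open>The coefficient form of \<open>T\<^sub>n = (K + K\<^sup>-\<^sup>1 + E) T\<^sub>n\<^sub>-\<^sub>1 - T\<^sub>n\<^sub>-\<^sub>2\<close>: the monomial
  \<open>[E\<^sup>r K\<^sup>m\<^sup>-\<^sup>j]\<close> arises by multiplying with \<open>K\<close>, with its inverse, or with \<open>E\<close>. The bound
  \<open>r + m + j \<ge> 2\<close> expresses that the Chebyshev recursion starts at \<open>n = 2\<close>.

  In the main case all five coefficients are multiples of the product \<open>P Q\<close> of two binomials,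
  after multiplication by \<open>A B (q\<^sup>r - q\<^sup>-\<^sup>r)\<close>. For \<open>r \<ge> 1\<close> and \<open>m, j \<ge> 0\<close> the factor \<open>A B\<close> vanishes
  only if \<open>r = 1\<close> and one of \<open>m\<close>, \<open>j\<close> is zero. Those cases are separate: every binomial involved
  is then \<open>0\<close> or \<open>1\<close>, and the recurrence is the splitting \<open>qdiff_add\<close>.\<close>
lemma cheb_coeff_int_recurrence:
  assumes "r + m + j \<ge> 2"
  shows "cheb_coeff_int r m j = qpow r * cheb_coeff_int r (m - 1) j
    + qpow (- r) * cheb_coeff_int r m (j - 1)
    + qpow (j - m) * cheb_coeff_int (r - 1) m j - cheb_coeff_int r (m - 1) (j - 1)"
proof -
  consider "r < 0 \<or> m < 0 \<or> j < 0" | "r = 0" "m \<ge> 0" "j \<ge> 0"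
    | "r = 1" "m = 0" "j \<ge> 1" | "r = 1" "m \<ge> 1" "j = 0"
    | "r \<ge> 1" "m \<ge> 0" "j \<ge> 0" "r \<ge> 2 \<or> (m \<ge> 1 \<and> j \<ge> 1)"
    using assms by linarith
  thus ?thesis
  proof cases
    case 1
    thus ?thesis by (auto simp: cheb_coeff_int_neg)
  next
    case 2
    thus ?thesis using assms
      by (cases "m = 0"; cases "j = 0"; cases "m = 1"; cases "j = 1")
        (simp_all add: cheb_coeff_int_neg cheb_coeff_int_0)
  next
    case 3
    have "qdiff 1 * cheb_coeff_int 1 0 j
        = qdiff 1 * (qpow (- 1) * cheb_coeff_int 1 0 (j - 1) + qpow j * cheb_coeff_int 0 0 j)"
      using 3 cheb_coeff_int_product[of 1 0 j] cheb_coeff_int_product[of 1 0 "j - 1"] qdiff_add[of j 1]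
      by (simp add: cheb_coeff_int_0 qgauss_int_def algebra_simps)
    thus ?thesis using 3 by (simp add: cheb_coeff_int_neg)
  next
    case 4
    have "qdiff 1 * cheb_coeff_int 1 m 0
        = qdiff 1 * (qpow 1 * cheb_coeff_int 1 (m - 1) 0 + qpow (- m) * cheb_coeff_int 0 m 0)"
      using 4 cheb_coeff_int_product[of 1 m 0] cheb_coeff_int_product[of 1 "m - 1" 0] qdiff_add[of 1 m]
      by (simp add: cheb_coeff_int_0 qgauss_int_def algebra_simps)
    thus ?thesis using 4 by (simp add: cheb_coeff_int_neg)
  next
    case 5
    define a where "a = r - 1"
    have r: "r = a + 1" and a: "a \<ge> 0" using 5 by (simp_all add: a_def)
    define A B P Q where "A = qdiff (a + m)" and "B = qdiff (a + j)"
      and "P = qgauss_int a m" and "Q = qgauss_int a j"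
    have nz: "A \<noteq> 0" "B \<noteq> 0" using 5 by (auto simp: A_def B_def a_def)
    have P: "A * qgauss_int a (m - 1) = qdiff m * P" and Q: "B * qgauss_int a (j - 1) = qdiff j * Q"
      using a by (simp_all add: A_def B_def P_def Q_def qgauss_int_shift_right)
    have prod: "qdiff r * cheb_coeff_int r m' j'
        = qdiff (r + m' + j') * qgauss_int a m' * qgauss_int a j'"
      for m' j'
      using cheb_coeff_int_product[of r] 5 by (simp add: a_def)
    have 0: "qdiff r * cheb_coeff_int r m j = qdiff (a + 1 + m + j) * P * Q"
      using prod[of m j] by (simp add: r P_def Q_def)
    have 1: "A * (qdiff r * cheb_coeff_int r (m - 1) j) = qdiff (a + m + j) * qdiff m * P * Q"
      using prod[of "m - 1" j] P by (simp add: r Q_def algebra_simps)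
    have 2: "B * (qdiff r * cheb_coeff_int r m (j - 1)) = qdiff (a + m + j) * qdiff j * P * Q"
      using prod[of m "j - 1"] Q by (simp add: r P_def algebra_simps)
    have 3: "A * B * (qdiff r * cheb_coeff_int r (m - 1) (j - 1))
        = qdiff (a + m + j - 1) * qdiff m * qdiff j * P * Q"
    proof -
      have "A * B * (qdiff r * cheb_coeff_int r (m - 1) (j - 1))
          = qdiff (a + m + j - 1) * (A * qgauss_int a (m - 1)) * (B * qgauss_int a (j - 1))"
        using prod[of "m - 1" "j - 1"] by (simp add: r algebra_simps)
      thus ?thesis by (simp add: P Q mult_ac)
    qed
    \<comment> \<open>For \<open>a = 0\<close> no product formula applies to \<open>cheb_coeff_int a m j\<close>; both sides are zero
      since then \<open>m\<close> and \<open>j\<close> are positive.\<close>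
    have 4: "A * B * cheb_coeff_int a m j = qdiff (a + m + j) * qdiff a * P * Q"
    proof (cases "a = 0")
      case True
      thus ?thesis using 5 by (auto simp: A_def B_def cheb_coeff_int_0)
    next
      case False
      have "qdiff a * (A * B * cheb_coeff_int a m j)
          = qdiff (a + m + j) * (A * qgauss_int (a - 1) m) * (B * qgauss_int (a - 1) j)"
        using cheb_coeff_int_product[of a m j] a False by (simp add: algebra_simps)
      also have "A * qgauss_int (a - 1) m = qdiff a * P"
        using qgauss_int_shift_left[of a m] a False by (simp add: A_def P_def)
      also have "B * qgauss_int (a - 1) j = qdiff a * Q"
        using qgauss_int_shift_left[of a j] a False by (simp add: B_def Q_def)
      finally have "qdiff a * (A * B * cheb_coeff_int a m j)
          = qdiff a * (qdiff (a + m + j) * qdiff a * P * Q)"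
        by (simp add: mult_ac)
      thus ?thesis using False by simp
    qed
    have "A * B * qdiff r * cheb_coeff_int r m j = (qdiff (a + 1 + m + j) * A * B) * (P * Q)"
      using 0 by (simp add: mult_ac)
    also have "\<dots> = qpow r * B * (qdiff (a + m + j) * qdiff m * P * Q)
        + qpow (- r) * A * (qdiff (a + m + j) * qdiff j * P * Q)
        + qpow (j - m) * qdiff r * (qdiff (a + m + j) * qdiff a * P * Q)
        - qdiff (a + m + j - 1) * qdiff m * qdiff j * P * Q"
      unfolding A_def B_def qdiff_identity r by (simp only: ring_distribs mult_ac)
    also have "\<dots> = A * B * qdiff r * (qpow r * cheb_coeff_int r (m - 1) j
        + qpow (- r) * cheb_coeff_int r m (j - 1)
        + qpow (j - m) * cheb_coeff_int a m j - cheb_coeff_int r (m - 1) (j - 1))"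
      unfolding 1[symmetric] 2[symmetric] 3[symmetric] 4[symmetric]
      by (simp only: ring_distribs mult_ac)
    finally show ?thesis
      using nz 5 by (simp add: a_def)
  qed
qed

section \<open>Evaluation of Chebyshev polynomials in a ring\<close>

lemma ipoly_at_bound:
  assumes "degree p \<le> d"
  shows "ipoly_at p x = (\<Sum>i\<le>d. of_int (coeff p i) * x ^ i)"
  unfolding ipoly_at_def using assms
  by (intro sum.mono_neutral_left) (auto simp: coeff_eq_0)

lemma ipoly_at_diff: "ipoly_at (p - p') x = ipoly_at p x - ipoly_at p' x"
  using ipoly_at_bound[of p "max (degree p) (degree p')" x]
    ipoly_at_bound[of p' "max (degree p) (degree p')" x]
    ipoly_at_bound[of "p - p'" "max (degree p) (degree p')" x]
  by (simp add: degree_diff_le_max left_diff_distrib sum_subtractf)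

lemma ipoly_at_X_mult: "ipoly_at ([:0, 1:] * p) x = x * ipoly_at p x"
proof -
  have "ipoly_at ([:0, 1:] * p) x = (\<Sum>i\<le>Suc (degree p). of_int (coeff (pCons 0 p) i) * x ^ i)"
    using degree_pCons_le[of 0 p] by (simp add: ipoly_at_bound)
  also have "\<dots> = (\<Sum>i\<le>degree p. of_int (coeff p i) * (x * x ^ i))"
    by (simp only: sum.atMost_Suc_shift) simp
  also have "\<dots> = (\<Sum>i\<le>degree p. x * (of_int (coeff p i) * x ^ i))"
    by (intro sum.cong HOL.refl) (metis mult.assoc mult_of_int_commute)
  finally show ?thesis by (simp add: ipoly_at_def sum_distrib_left)
qed

lemma ipoly_at_chebT_Suc_Suc:
  "ipoly_at (chebT (Suc (Suc n))) x = x * ipoly_at (chebT (Suc n)) x - ipoly_at (chebT n) x"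
  by (simp only: chebT.simps ipoly_at_diff ipoly_at_X_mult)

section \<open>Weyl monomials and the expansion\<close>

lemma Kpow_0 [simp]: "Kpow 0 = 1"
  by (simp add: Kpow_def)

lemma genK_Kpow: "genK * Kpow b = Kpow (b + 1)"
proof (cases b rule: int_cases)
  case (nonneg k)
  thus ?thesis by (simp add: Kpow_def nat_add_distrib)
next
  case (neg k)
  hence "genK * Kpow b = (genK * genKinv) * genKinv ^ k"
    by (simp add: Kpow_def mult.assoc nat_add_distrib flip: power_Suc)
  thus ?thesis using neg by (cases "k = 0") (auto simp: Kpow_def genK_genKinv)
qed

lemma genKinv_Kpow: "genKinv * Kpow b = Kpow (b - 1)"
proof -
  have "genKinv * Kpow b = genKinv * genK * Kpow (b - 1)"
    using genK_Kpow[of "b - 1"] by (simp add: mult.assoc)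
  thus ?thesis by (simp add: genKinv_genK)
qed

text \<open>Left multiplication by a generator sends a Weyl monomial to a multiple of a Weyl monomial.
  For \<open>K\<close> and its inverse the form with the powers of \<open>K\<close> on the left is the convenient one.\<close>
lemma genK_weyl: "genK * weyl a b = scal (qpow (int a)) * weyl a (b + 1)"
proof -
  have "genK * weyl a b = scal (qpow (- (int a * b))) * ((genK * Kpow b) * genE ^ a)"
    by (simp only: weyl_altdef mult.assoc scal_left_commute)
  thus ?thesis
    by (simp add: weyl_altdef mult.assoc scal_qpow_scal genK_Kpow algebra_simps)
qed

lemma genKinv_weyl: "genKinv * weyl a b = scal (qpow (- int a)) * weyl a (b - 1)"
proof -
  have "genKinv * weyl a b = scal (qpow (- (int a * b))) * ((genKinv * Kpow b) * genE ^ a)"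
    by (simp only: weyl_altdef mult.assoc scal_left_commute)
  thus ?thesis
    by (simp add: weyl_altdef mult.assoc scal_qpow_scal genKinv_Kpow algebra_simps)
qed

lemma genE_weyl: "genE * weyl a b = scal (qpow (- b)) * weyl (Suc a) b"
proof -
  have "genE * weyl a b = scal (qpow (int a * b)) * (genE ^ Suc a * Kpow b)"
    by (simp only: weyl_def mult.assoc scal_left_commute power_Suc)
  thus ?thesis
    by (simp only: weyl_def mult.assoc scal_qpow_scal) (simp add: algebra_simps)
qed

text \<open>The coefficient vanishes for negative \<open>r\<close>, so the truncation \<open>nat r\<close> is harmless.\<close>
definition cheb_term :: "int \<Rightarrow> int \<Rightarrow> int \<Rightarrow> qalg"
  where "cheb_term n r j = scal (cheb_coeff_int r (n - r - j) j) * weyl (nat r) (n - r - 2 * j)"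

lemma cheb_term_eq_0: "r < 0 \<or> j < 0 \<or> n < r + j \<Longrightarrow> cheb_term n r j = 0"
  by (auto simp: cheb_term_def cheb_coeff_int_neg scal_0)

lemma scal_diff: "scal (a - b) = scal a - scal b"
  using scal_add[of "a - b" b] by (simp add: algebra_simps)

lemma cheb_term_recurrence:
  assumes "n \<ge> 0" "r \<ge> 0"
  shows "cheb_term (n + 2) r j = genK * cheb_term (n + 1) r j + genKinv * cheb_term (n + 1) r (j - 1)
    + genE * cheb_term (n + 1) (r - 1) j - cheb_term n r (j - 1)"
proof -
  define m where "m = n + 2 - r - j"
  define w where "w = weyl (nat r) (m - j)"
  have K: "genK * cheb_term (n + 1) r j = scal (qpow r * cheb_coeff_int r (m - 1) j) * w"
    using assms
    by (simp add: cheb_term_def scal_left_commute[of genK] genK_weyl w_def m_def scal_mult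
        mult.assoc scal_left_commute[of "scal _"] algebra_simps)
  have Kinv: "genKinv * cheb_term (n + 1) r (j - 1)
      = scal (qpow (- r) * cheb_coeff_int r m (j - 1)) * w"
    using assms
    by (simp add: cheb_term_def scal_left_commute[of genKinv] genKinv_weyl w_def m_def scal_mult
        mult.assoc scal_left_commute[of "scal _"] algebra_simps)
  have E: "genE * cheb_term (n + 1) (r - 1) j = scal (qpow (j - m) * cheb_coeff_int (r - 1) m j) * w"
  proof (cases "r = 0")
    case True
    thus ?thesis by (simp add: cheb_term_def cheb_coeff_int_neg scal_0)
  next
    case False
    hence "Suc (nat (r - 1)) = nat r" using assms by linarith
    thus ?thesis
      by (simp add: cheb_term_def scal_left_commute[of genE] genE_weyl w_def m_def scal_mult
          mult.assoc scal_left_commute[of "scal _"] algebra_simps)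
  qed
  have T: "cheb_term n r (j - 1) = scal (cheb_coeff_int r (m - 1) (j - 1)) * w"
    by (simp add: cheb_term_def m_def w_def algebra_simps)
  have "cheb_term (n + 2) r j = scal (cheb_coeff_int r m j) * w"
    by (simp add: cheb_term_def m_def w_def algebra_simps)
  also have "cheb_coeff_int r m j = qpow r * cheb_coeff_int r (m - 1) j
    + qpow (- r) * cheb_coeff_int r m (j - 1)
    + qpow (j - m) * cheb_coeff_int (r - 1) m j - cheb_coeff_int r (m - 1) (j - 1)"
    using assms by (intro cheb_coeff_int_recurrence) (simp add: m_def)
  finally show ?thesis
    unfolding K Kinv E T by (simp add: scal_add scal_diff algebra_simps)
qed

definition cheb_sum :: "nat \<Rightarrow> qalg"
  where "cheb_sum n = (\<Sum>r=0..n. \<Sum>j=0..n-r. cheb_term (int n) (int r) (int j))"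

text \<open>Terms outside the triangle vanish. A square independent of \<open>n\<close> lets the sums for
  \<open>n\<close>, \<open>n + 1\<close> and \<open>n + 2\<close> range over the same indices.\<close>
lemma cheb_sum_square:
  assumes "n < N"
  shows "cheb_sum n = (\<Sum>r<N. \<Sum>j<N. cheb_term (int n) (int r) (int j))"
proof -
  have inner: "(\<Sum>j=0..n-r. cheb_term (int n) (int r) (int j))
      = (\<Sum>j<N. cheb_term (int n) (int r) (int j))" if "r \<le> n" for r
    using assms that by (intro sum.mono_neutral_left) (auto intro!: cheb_term_eq_0)
  have "cheb_sum n = (\<Sum>r=0..n. \<Sum>j<N. cheb_term (int n) (int r) (int j))"
    unfolding cheb_sum_def by (intro sum.cong HOL.refl inner) auto
  also have "\<dots> = (\<Sum>r<N. \<Sum>j<N. cheb_term (int n) (int r) (int j))"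
    using assms by (intro sum.mono_neutral_left) (auto intro!: sum.neutral cheb_term_eq_0)
  finally show ?thesis .
qed

lemma sum_int_shift:
  fixes f :: "int \<Rightarrow> 'a::comm_monoid_add"
  assumes "f (- 1) = 0" "f (int N - 1) = 0"
  shows "(\<Sum>k<N. f (int k - 1)) = (\<Sum>k<N. f (int k))"
proof (cases N)
  case (Suc M)
  have "(\<Sum>k<Suc M. f (int k - 1)) = (\<Sum>k<M. f (int k))"
    using assms by (simp only: sum.lessThan_Suc_shift) simp
  thus ?thesis using assms Suc by simp
qed simp

text \<open>Summation of the termwise recurrence. The shifts \<open>j - 1\<close> and \<open>r - 1\<close> are invisible in the
  sums, as the terms that enter or leave the square are zero.\<close>
lemma cheb_sum_Suc_Suc:
  "cheb_sum (Suc (Suc n)) = (genK + genKinv + genE) * cheb_sum (Suc n) - cheb_sum n"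
proof -
  \<comment> \<open>large enough for the indices of \<open>n + 2\<close>, and for those of \<open>n + 1\<close> and \<open>n\<close> shifted by one\<close>
  define N where "N = n + 3"
  have N: "Suc n < N - 1" "n < N - 1" "Suc n < N" "Suc (Suc n) < N"
    by (simp_all add: N_def)
  let ?t = "\<lambda>k r j. cheb_term (int k) r j"
  have shift_j: "(\<Sum>r<N. \<Sum>j<N. ?t k (int r) (int j - 1)) = cheb_sum k" if "k < N - 1" for k
  proof -
    have "(\<Sum>j<N. ?t k (int r) (int j - 1)) = (\<Sum>j<N. ?t k (int r) (int j))" for r
      using that by (intro sum_int_shift cheb_term_eq_0) auto
    thus ?thesis using that by (simp add: cheb_sum_square[of k N])
  qed
  have shift_r: "(\<Sum>r<N. \<Sum>j<N. ?t k (int r - 1) (int j)) = cheb_sum k" if "k < N - 1" for k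
    using that sum_int_shift[of "\<lambda>r. \<Sum>j<N. ?t k r (int j)" N]
    by (simp add: cheb_sum_square[of k N] cheb_term_eq_0)
  have "cheb_sum (Suc (Suc n)) = (\<Sum>r<N. \<Sum>j<N. genK * ?t (Suc n) (int r) (int j)
      + genKinv * ?t (Suc n) (int r) (int j - 1)
      + genE * ?t (Suc n) (int r - 1) (int j) - ?t n (int r) (int j - 1))"
    unfolding cheb_sum_square[OF N(4)]
    by (intro sum.cong HOL.refl) (use cheb_term_recurrence[of "int n"] in \<open>simp add: add_ac\<close>)
  also have "\<dots> = genK * cheb_sum (Suc n) + genKinv * cheb_sum (Suc n) + genE * cheb_sum (Suc n)
      - cheb_sum n"
    by (simp only: sum.distrib sum_subtractf sum_distrib_left[symmetric] shift_j[OF N(1)]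
        shift_j[OF N(2)] shift_r[OF N(1)] cheb_sum_square[OF N(3), symmetric])
  finally show ?thesis by (simp add: algebra_simps)
qed

text \<open>The row \<open>r = 0\<close> gives the two powers of \<open>K\<close> and the row \<open>r = n\<close>, a single term, gives \<open>E\<^sup>n\<close>.\<close>
lemma cheb_sum_eq:
  assumes "n \<ge> 1"
  shows "cheb_sum n = Kpow (int n) + Kpow (- int n) + genE ^ n
      + (\<Sum>r=1..n-1. \<Sum>j=0..n-r. scal (cheb_coeff r (n - r - j) j) * weyl r (int n - 2 * int j - int r))"
proof -
  let ?s = "\<lambda>r. \<Sum>j=0..n-r. cheb_term (int n) (int r) (int j)"
  have "cheb_sum n = sum ?s (insert 0 (insert n {1..n-1}))"
    unfolding cheb_sum_def using assms by (intro sum.cong) auto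
  hence split: "cheb_sum n = ?s 0 + ?s n + sum ?s {1..n-1}"
    using assms by (simp add: add.assoc)
  have "?s 0 = (\<Sum>j\<in>{0, n}. cheb_term (int n) 0 (int j))"
    by (intro sum.mono_neutral_cong_right) (auto simp: cheb_term_def cheb_coeff_int_0 scal_0)
  also have "\<dots> = Kpow (int n) + Kpow (- int n)"
    using assms by (simp add: cheb_term_def cheb_coeff_int_0 scal_1 weyl_def)
  finally have s0: "?s 0 = Kpow (int n) + Kpow (- int n)" .
  obtain a where "n = Suc a" using assms by (cases n) auto
  hence sn: "?s n = genE ^ n"
    by (simp add: cheb_term_def cheb_coeff_int_def cheb_coeff_def scal_1 weyl_def nat_add_distrib)
  have "sum ?s {1..n-1} = (\<Sum>r=1..n-1. \<Sum>j=0..n-r. scal (cheb_coeff r (n - r - j) j)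
      * weyl r (int n - 2 * int j - int r))"
  proof (intro sum.cong HOL.refl)
    fix r j
    assume "r \<in> {1..n-1}" "j \<in> {0..n-r}"
    moreover have "weyl r (int n - int r - 2 * int j) = weyl r (int n - 2 * int j - int r)"
      by (simp add: algebra_simps)
    moreover have "nat (int n - int r - int j) = n - r - j" by linarith
    ultimately show "cheb_term (int n) (int r) (int j)
        = scal (cheb_coeff r (n - r - j) j) * weyl r (int n - 2 * int j - int r)"
      by (auto simp: cheb_term_def cheb_coeff_int_def)
  qed
  thus ?thesis unfolding split s0 sn by simp
qed

lemma ipoly_at_chebT:
  "ipoly_at (chebT n) (genK + genKinv + genE) = cheb_sum n"
proof (induction n rule: chebT.induct)
  case 1
  have "(2 :: laurent) = 1 + 1" by simp
  hence "scal 2 = 2" by (simp only: scal_add scal_1) simp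
  thus ?case by (simp add: cheb_sum_def cheb_term_def cheb_coeff_int_0 ipoly_at_def weyl_def scal_1)
next
  case 2
  show ?case
    by (simp add: cheb_sum_eq ipoly_at_def Kpow_def)
next
  case (3 n)
  thus ?case by (simp only: ipoly_at_chebT_Suc_Suc cheb_sum_Suc_Suc)
qed

theorem proposition1p5:
  fixes n :: nat
  assumes "n \<ge> 1"
  shows "\<exists>c :: nat \<Rightarrow> nat \<Rightarrow> laurent.
    (\<forall>r\<in>{1..n-1}. \<forall>j\<in>{0..n-r}. to_fract (c r j) = c_frac n r j) \<and>
    ipoly_at (chebT n) (genK + genKinv + genE) =
      Kpow (int n) + Kpow (- int n) + genE ^ n
      + (\<Sum>r=1..n-1. \<Sum>j=0..n-r. scal (c r j) * weyl r (int n - 2 * int j - int r)) \<and>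
    (\<forall>r\<in>{1..n-1}. \<forall>j\<in>{0..n-r}. nonneg_laurent (c r j)) \<and>
    (\<forall>z::complex. has_mult_order (z\<^sup>2) n \<longrightarrow>
      (\<forall>r\<in>{1..n-1}. \<forall>j\<in>{0..n-r}. laurent_eval z (c r j) = 0))"
proof (intro exI[of _ "\<lambda>r j. cheb_coeff r (n - r - j) j"] conjI ballI allI impI)
  fix r j assume "r \<in> {1..n-1}" "j \<in> {0..n-r}"
  thus "to_fract (cheb_coeff r (n - r - j) j) = c_frac n r j"
    by (intro to_fract_cheb_coeff) auto
next
  show "ipoly_at (chebT n) (genK + genKinv + genE) =
      Kpow (int n) + Kpow (- int n) + genE ^ n
      + (\<Sum>r=1..n-1. \<Sum>j=0..n-r. scal (cheb_coeff r (n - r - j) j)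
          * weyl r (int n - 2 * int j - int r))"
    using assms by (simp only: ipoly_at_chebT cheb_sum_eq)
next
  fix z :: complex and r j
  assume "has_mult_order (z\<^sup>2) n" "r \<in> {1..n-1}" "j \<in> {0..n-r}"
  thus "laurent_eval z (cheb_coeff r (n - r - j) j) = 0"
    by (intro laurent_eval_cheb_coeff_root_of_unity[of z n]) auto
qed (rule nonneg_laurent_cheb_coeff)

end
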